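(* Let $C,A^1,\dots,A^m\in\mathscr S_n$, $b\in\mathbb R^m$ and $0\le\ell\le m$ be the data of the semidefinite program in general form described in the context, and let $\bar C$, $\bar A^1,\dots,\bar A^m$, $\bar{\mathscr A}$, $\bar{\mathscr A}^{\top}$, $\bar X$, $\bar Z$ be the expanded objects of its standard-form reformulation. Assume that the constraints formed through $\bar{\mathscr A}$ are linearly independent. Then the $y$-update step of the algorithm ADAL applied to the standard-form reformulation, reading as $$y=(\bar{\mathscr A}\bar{\mathscr A}^{\top})^{-1}\Big(\tfrac1\sigma b-\bar{\mathscr A}\big(\tfrac1\sigma\bar X-\bar C+\bar Z\big)\Big),$$ can be performed in terms of the matrices of the original general-form problem only, namely in terms of the matrices $C$, $A^i$ for all $i=1,\dots,m$, $X$ and $Z$.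
   Context: $\mathscr S_n$ is the space of real symmetric $n\times n$ matrices with inner product $\langle X,Y\rangle=\mathrm{trace}(XY)$, and $\mathscr S_n^+$ is its cone of positive semidefinite matrices. $\mathrm{Diag}(v)$ is the diagonal matrix with the entries of $v$ on the diagonal. The semidefinite program in general form is: minimize $\langle C,X\rangle$ subject to $\langle A^i,X\rangle\le b_i$ for $i=1,\dots,\ell$, $\langle A^j,X\rangle=b_j$ for $j=\ell+1,\dots,m$, $X\in\mathscr S_n^+$. Adding slack variables $s_i\ge0$, $i=1,\dots,\ell$, it is rewritten in standard form over $\mathscr S_{n+\ell}$: minimize $\langle\bar C,\bar X\rangle$ subject to $\bar{\mathscr A}\bar X=b$, $\bar X\in\mathscr S_{n+\ell}^+$, where $$\bar X=\begin{pmatrix}X&0\\0&\mathrm{Diag}(s)\end{pmatrix},\quad \bar C=\begin{pmatrix}C&0\\0&0\end{pmatrix},\quad \bar A^i=\begin{pmatrix}A^i&0\\0&e_ie_i^T\end{pmatrix}\ (1\le i\le\ell),\quad \bar A^j=\begin{pmatrix}A^j&0\\0&0\end{pmatrix}\ (\ell<j\le m),$$ with $e_i$ the $i$-th standard basis (column) vector of $\mathbb R^\ell$. The operator $\bar{\mathscr A}:\mathscr S_{n+\ell}\to\mathbb R^m$ is given by $(\bar{\mathscr A}Y)_i=\langle\bar A^i,Y\rangle$, and its adjoint is $\bar{\mathscr A}^{\top}y=\sum_{i=1}^m y_i\bar A^i$. The dual of the standard-form problem has the constraint $\bar{\mathscr A}^{\top}y+\bar Z=\bar C$ with $\bar Z\in\mathscr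 S_{n+\ell}^+$, where $$\bar Z=\begin{pmatrix}Z&0\\0&\mathrm{Diag}(p)\end{pmatrix},\qquad Z\in\mathscr S_n,\ p\in\mathbb R^\ell.$$ ADAL (alternating direction augmented Lagrangian method) applied to the standard-form problem iterates, with a penalty parameter $\sigma>0$: first the update of $y$ displayed in the claim; then $W=\tfrac1\sigma\bar X-\bar C+\bar{\mathscr A}^{\top}y$; then $\bar Z=-(W)_-$ and $\bar X=\sigma(W)_+$, where $(W)_+$ and $(W)_-$ are the projections of $W$ onto the positive semidefinite and negative semidefinite cones; then $\sigma$ is updated. The purpose of the statement is that the augmented $(n+\ell)\times(n+\ell)$ matrices $\bar C,\bar A^i,\bar X,\bar Z$ need not be stored to perform the $y$-update. *)

theory Defs
  imports "Jordan_Normal_Form.Gauss_Jordan_Elimination"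
begin

text \<open>Matrices and vectors are those of Jordan_Normal_Form, so that the dimensions n, m, l are
  ordinary natural numbers and the boundary cases l = 0 and l = m are included. Constraints are
  numbered from 0: the indices i < l are the inequalities and l \<le> i < m the equalities.\<close>

definition sym_mats :: "nat \<Rightarrow> real mat set" where
  "sym_mats N = {X \<in> carrier_mat N N. transpose_mat X = X}"

definition mat_inner :: "real mat \<Rightarrow> real mat \<Rightarrow> real" where
  "mat_inner X Y = sum_list (diag_mat (X * Y))"

definition Diag :: "real vec \<Rightarrow> real mat" where
  "Diag v = mat_diag (dim_vec v) (\<lambda>i. v $ i)"

definition constr_op :: "nat \<Rightarrow> (nat \<Rightarrow> real mat) \<Rightarrow> real mat \<Rightarrow> real vec" where
  "constr_op m A Y = vec m (\<lambda>i. mat_inner (A i) Y)"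

text \<open>The matrix sum of the A i scaled by y $ i over i < m, written entrywise because the type of
  matrices of all sizes is not an additive monoid.\<close>

definition constr_adj :: "nat \<Rightarrow> nat \<Rightarrow> (nat \<Rightarrow> real mat) \<Rightarrow> real vec \<Rightarrow> real mat" where
  "constr_adj N m A y = mat N N (\<lambda>rc. \<Sum>i<m. y $ i * A i $$ rc)"

text \<open>The m by m matrix of the linear map sending y to constr_op m A (constr_adj N m A y): its
  columns are the images of the unit vectors.\<close>

definition constr_op_adj :: "nat \<Rightarrow> nat \<Rightarrow> (nat \<Rightarrow> real mat) \<Rightarrow> real mat" where
  "constr_op_adj N m A =
     mat_of_cols m (map (\<lambda>j. constr_op m A (constr_adj N m A (unit_vec m j))) [0..<m])"

text \<open>Linear independence of the family A 0, ..., A (m - 1); in particular repetitions are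
  excluded.\<close>

definition constr_lin_indep :: "nat \<Rightarrow> nat \<Rightarrow> (nat \<Rightarrow> real mat) \<Rightarrow> bool" where
  "constr_lin_indep N m A \<longleftrightarrow>
     (\<forall>c \<in> carrier_vec m. constr_adj N m A c = 0\<^sub>m N N \<longrightarrow> c = 0\<^sub>v m)"

definition adal_y_update ::
  "nat \<Rightarrow> nat \<Rightarrow> real \<Rightarrow> real vec \<Rightarrow> real mat \<Rightarrow> (nat \<Rightarrow> real mat) \<Rightarrow> real mat \<Rightarrow> real mat \<Rightarrow> real vec"
where
  "adal_y_update N m \<sigma> b C A X Z =
     the (mat_inverse (constr_op_adj N m A)) *\<^sub>v
       ((1/\<sigma>) \<cdot>\<^sub>v b - constr_op m A ((1/\<sigma>) \<cdot>\<^sub>m X - C + Z))"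

definition block_diag :: "nat \<Rightarrow> nat \<Rightarrow> real mat \<Rightarrow> real mat \<Rightarrow> real mat" where
  "block_diag n l M D = four_block_mat M (0\<^sub>m n l) (0\<^sub>m l n) D"

definition C_bar :: "nat \<Rightarrow> nat \<Rightarrow> real mat \<Rightarrow> real mat" where
  "C_bar n l C = block_diag n l C (0\<^sub>m l l)"

text \<open>The lower right block for i < l is the product of the column e_i with the row e_i.\<close>

definition A_bar :: "nat \<Rightarrow> nat \<Rightarrow> (nat \<Rightarrow> real mat) \<Rightarrow> nat \<Rightarrow> real mat" where
  "A_bar n l A i = block_diag n l (A i)
     (if i < l then mat_of_cols l [unit_vec l i] * mat_of_rows l [unit_vec l i] else 0\<^sub>m l l)"

definition X_bar :: "nat \<Rightarrow> nat \<Rightarrow> real mat \<Rightarrow> real vec \<Rightarrow> real mat" where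
  "X_bar n l X s = block_diag n l X (Diag s)"

definition Z_bar :: "nat \<Rightarrow> nat \<Rightarrow> real mat \<Rightarrow> real vec \<Rightarrow> real mat" where
  "Z_bar n l Z p = block_diag n l Z (Diag p)"

end

theory Submission
  imports Defs "Jordan_Normal_Form.Determinant"
begin

text \<open>The trace inner product splits over block diagonal matrices. Hence the Gram matrix of the
  expanded constraints is the Gram matrix of the A i plus the identity on the first l coordinates
  (the slack blocks are orthonormal), and the slack part of the right-hand side only reads off
  entries of s and p. The Gram matrix is invertible because a vector in its kernel is the
  coefficient vector of a vanishing linear combination of the constraint matrices.\<close>

lemma mat_inner_sum:
  assumes "X \<in> carrier_mat n n" "Y \<in> carrier_mat n n"
  shows "mat_inner X Y = (\<Sum>i<n. \<Sum>j<n. X $$ (i,j) * Y $$ (j,i))"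
  using assms
  by (auto simp: mat_inner_def diag_mat_def sum_list_sum_nth scalar_prod_def atLeast0LessThan
      intro!: sum.cong)

lemma block_diag_carrier[simp]:
  "M \<in> carrier_mat n n \<Longrightarrow> D \<in> carrier_mat l l \<Longrightarrow> block_diag n l M D \<in> carrier_mat (n + l) (n + l)"
  by (simp add: block_diag_def)

lemma mat_inner_block_diag:
  assumes "M \<in> carrier_mat n n" "M' \<in> carrier_mat n n" "D \<in> carrier_mat l l" "D' \<in> carrier_mat l l"
  shows "mat_inner (block_diag n l M D) (block_diag n l M' D') = mat_inner M M' + mat_inner D D'"
proof -
  have "block_diag n l M D * block_diag n l M' D' = block_diag n l (M * M') (D * D')"
    unfolding block_diag_def
    by (subst mult_four_block_mat[where ?n1.0 = n and ?n2.0 = l]) (use assms in auto)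
  moreover have "diag_mat (block_diag n l (M * M') (D * D')) = diag_mat (M * M') @ diag_mat (D * D')"
    unfolding block_diag_def by (rule diag_four_block_mat) (use assms in auto)
  ultimately show ?thesis by (simp add: mat_inner_def)
qed

lemma constr_adj_carrier[simp]: "constr_adj N m A y \<in> carrier_mat N N"
  by (simp add: constr_adj_def)

text \<open>Linearity of the trace form in its second argument. It is derived entrywise, by
  exchanging finite sums, because \<open>constr_adj\<close> is itself given entrywise.\<close>

lemma mat_inner_constr_adj:
  assumes "B \<in> carrier_mat N N" "\<And>i. i < m \<Longrightarrow> A i \<in> carrier_mat N N"
  shows "mat_inner B (constr_adj N m A y) = (\<Sum>i<m. y $ i * mat_inner B (A i))"
proof -
  have "mat_inner B (constr_adj N m A y)
      = (\<Sum>r<N. \<Sum>c<N. \<Sum>i<m. y $ i * (B $$ (r,c) * A i $$ (c,r)))"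
    unfolding mat_inner_sum[OF assms(1) constr_adj_carrier]
    by (auto simp: constr_adj_def sum_distrib_left intro!: sum.cong)
  also have "\<dots> = (\<Sum>r<N. \<Sum>i<m. \<Sum>c<N. y $ i * (B $$ (r,c) * A i $$ (c,r)))"
    by (intro sum.cong refl sum.swap)
  also have "\<dots> = (\<Sum>i<m. \<Sum>r<N. \<Sum>c<N. y $ i * (B $$ (r,c) * A i $$ (c,r)))"
    by (rule sum.swap)
  also have "\<dots> = (\<Sum>i<m. y $ i * mat_inner B (A i))"
    by (intro sum.cong refl) (simp add: mat_inner_sum[OF assms(1) assms(2)] sum_distrib_left)
  finally show ?thesis .
qed

lemma mat_inner_commute:
  assumes "X \<in> carrier_mat n n" "Y \<in> carrier_mat n n"
  shows "mat_inner X Y = mat_inner Y X"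
  unfolding mat_inner_sum[OF assms] mat_inner_sum[OF assms(2,1)]
  by (subst sum.swap) (simp add: mult.commute)

lemma constr_op_adj_carrier[simp]: "constr_op_adj N m A \<in> carrier_mat m m"
  by (rule carrier_matI) (simp_all add: constr_op_adj_def)

lemmas constr_op_adj_dim[simp] = carrier_matD[OF constr_op_adj_carrier]

text \<open>Column j is the image of the unit vector j, whose adjoint image is \<open>A j\<close>;
  this identifies the composed operator with a Gram matrix.\<close>

lemma constr_op_adj_index:
  assumes "\<And>i. i < m \<Longrightarrow> A i \<in> carrier_mat N N" "i < m" "j < m"
  shows "constr_op_adj N m A $$ (i,j) = mat_inner (A i) (A j)"
proof -
  have "constr_op_adj N m A $$ (i,j) = mat_inner (A i) (constr_adj N m A (unit_vec m j))"
    using assms(2,3) by (simp add: constr_op_adj_def mat_of_cols_index constr_op_def)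
  also have "\<dots> = (\<Sum>k<m. if k = j then mat_inner (A i) (A k) else 0)"
    using assms(3) by (subst mat_inner_constr_adj) (auto simp: assms(1,2) if_distrib[of "\<lambda>x. x * a" for a] cong: if_cong)
  also have "\<dots> = mat_inner (A i) (A j)" using assms(3) by simp
  finally show ?thesis .
qed

text \<open>For symmetric \<open>S\<close> the trace of \<open>S * S\<close> is the sum of the
  squared entries. Symmetry matters: a nonzero nilpotent matrix can have a square of trace
  zero.\<close>

lemma mat_inner_self_eq_0:
  assumes "S \<in> sym_mats N" "mat_inner S S = 0"
  shows "S = 0\<^sub>m N N"
proof -
  have S: "S \<in> carrier_mat N N" and tr: "transpose_mat S = S"
    using assms(1) by (auto simp: sym_mats_def)
  have sym: "S $$ (j,i) = S $$ (i,j)" if "i < N" "j < N" for i j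
    using S that arg_cong[OF tr, of "\<lambda>M. M $$ (i,j)"] by simp
  have "(\<Sum>i<N. \<Sum>j<N. (S $$ (i,j))\<^sup>2) = mat_inner S S"
    unfolding mat_inner_sum[OF S S] by (auto simp: sym power2_eq_square intro!: sum.cong)
  then have "(\<Sum>i<N. \<Sum>j<N. (S $$ (i,j))\<^sup>2) = 0" using assms(2) by simp
  then have "\<forall>i<N. \<forall>j<N. S $$ (i,j) = 0"
    by (simp add: sum_nonneg_eq_0_iff sum_nonneg)
  then show ?thesis using S by (intro eq_matI) auto
qed

lemma sym_mats_constr_adj:
  assumes "\<And>i. i < m \<Longrightarrow> A i \<in> sym_mats N"
  shows "constr_adj N m A y \<in> sym_mats N"
proof -
  have "A i $$ (c,r) = A i $$ (r,c)" if "i < m" "r < N" "c < N" for i r c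
    using assms[OF that(1)] that(2,3) index_transpose_mat(1)[of r "A i" c]
    by (auto simp: sym_mats_def)
  then show ?thesis
    by (auto simp: sym_mats_def constr_adj_def intro!: eq_matI sum.cong)
qed

lemma invertible_constr_op_adj:
  assumes A: "\<And>i. i < m \<Longrightarrow> A i \<in> sym_mats N" and indep: "constr_lin_indep N m A"
  shows "invertible_mat (constr_op_adj N m A)"
proof -
  let ?G = "constr_op_adj N m A"
  have Ac: "A i \<in> carrier_mat N N" if "i < m" for i using A[OF that] by (simp add: sym_mats_def)
  have "det ?G \<noteq> 0"
  proof
    assume "det ?G = 0"
    then obtain v where v: "v \<in> carrier_vec m" "v \<noteq> 0\<^sub>v m" and Gv: "?G *\<^sub>v v = 0\<^sub>v m"
      using det_0_iff_vec_prod_zero_field[OF constr_op_adj_carrier] by blast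
    let ?S = "constr_adj N m A v"
    have inner0: "mat_inner (A i) ?S = 0" if "i < m" for i
    proof -
      have "mat_inner (A i) ?S = (\<Sum>j<m. ?G $$ (i,j) * v $ j)"
        using that by (simp add: mat_inner_constr_adj Ac constr_op_adj_index mult.commute)
      also have "\<dots> = (?G *\<^sub>v v) $ i"
        using that v(1) by (simp add: scalar_prod_def atLeast0LessThan)
      finally show ?thesis using Gv that by simp
    qed
    \<comment> \<open>\<open>?S\<close> is a combination of the \<open>A i\<close>, each of which is
      orthogonal to \<open>?S\<close> by \<open>inner0\<close>.\<close>
    have "mat_inner ?S ?S = 0"
      by (simp add: mat_inner_constr_adj[OF constr_adj_carrier Ac]
          mat_inner_commute[OF constr_adj_carrier Ac] inner0)
    then have "?S = 0\<^sub>m N N" by (intro mat_inner_self_eq_0 sym_mats_constr_adj A)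
    then show False using indep v by (auto simp: constr_lin_indep_def)
  qed
  \<comment> \<open>Being a unit of the matrix ring supplies the two-sided inverse that
    \<open>invertible_mat\<close> asks for.\<close>
  then have "?G \<in> Units (ring_mat TYPE(real) m ())"
    by (rule det_non_zero_imp_unit[OF constr_op_adj_carrier])
  then obtain B where "B \<in> carrier_mat m m" "B * ?G = 1\<^sub>m m" "?G * B = 1\<^sub>m m"
    by (auto simp: Units_def ring_mat_simps)
  then show ?thesis
    unfolding invertible_mat_def inverts_mat_def by auto
qed

text \<open>Naming the lower right block of \<open>A_bar\<close> lets inequalities and equalities be
  treated alike.\<close>

definition slack_block :: "nat \<Rightarrow> nat \<Rightarrow> real mat" where
  "slack_block l i =
     (if i < l then mat_of_cols l [unit_vec l i] * mat_of_rows l [unit_vec l i] else 0\<^sub>m l l)"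

lemma A_bar_slack_block: "A_bar n l A i = block_diag n l (A i) (slack_block l i)"
  by (simp add: A_bar_def slack_block_def)

lemma slack_block_carrier[simp]: "slack_block l i \<in> carrier_mat l l"
  by (rule carrier_matI) (simp_all add: slack_block_def)

text \<open>One formula covers both cases: for i \<ge> l the condition \<open>r = i\<close> fails
  for every r < l, which gives the zero block.\<close>

lemma slack_block_index:
  "r < l \<Longrightarrow> c < l \<Longrightarrow> slack_block l i $$ (r,c) = (if r = i \<and> c = i then 1 else 0)"
  by (auto simp: slack_block_def scalar_prod_def mat_of_cols_index mat_of_rows_index)

lemma mat_inner_slack_block:
  assumes D: "D \<in> carrier_mat l l"
  shows "mat_inner (slack_block l i) D = (if i < l then D $$ (i,i) else 0)"
proof -
  \<comment> \<open>The conditionals are nested so that the two sums collapse one after the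
    other.\<close>
  have "mat_inner (slack_block l i) D = (\<Sum>r<l. \<Sum>c<l. if c = i then if r = i then D $$ (i,i) else 0 else 0)"
    unfolding mat_inner_sum[OF slack_block_carrier D]
    by (auto simp: slack_block_index if_distrib[of "\<lambda>x. x * a" for a]
        intro!: sum.cong cong: if_cong)
  then show ?thesis by simp
qed

lemma sym_mats_A_bar:
  assumes "A i \<in> sym_mats n"
  shows "A_bar n l A i \<in> sym_mats (n + l)"
proof -
  have "transpose_mat (slack_block l i) = slack_block l i"
    by (rule eq_matI)
       (simp_all add: slack_block_index carrier_matD[OF slack_block_carrier])
  then show ?thesis
    using assms
    by (simp add: sym_mats_def A_bar_slack_block)
       (simp add: block_diag_def transpose_four_block_mat[OF _ zero_carrier_mat zero_carrier_mat])
qed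

text \<open>The slack blocks of i and j contribute 1 exactly when i = j < l, and 0 otherwise: this
  is the identity padded with zeros.\<close>

lemma constr_op_adj_A_bar:
  assumes lm: "l \<le> m" and A: "\<And>i. i < m \<Longrightarrow> A i \<in> carrier_mat n n"
  shows "constr_op_adj (n + l) m (A_bar n l A)
    = constr_op_adj n m A + block_diag l (m - l) (1\<^sub>m l) (0\<^sub>m (m - l) (m - l))" (is "?L = _ + ?B")
proof (rule eq_matI)
  \<comment> \<open>The size is \<open>l + (m - l)\<close>, which equals m under truncated
    subtraction because l \<le> m.\<close>
  have B: "?B \<in> carrier_mat m m"
    using block_diag_carrier[OF one_carrier_mat zero_carrier_mat, of l "m - l"] lm by simp
  show "dim_row ?L = dim_row (constr_op_adj n m A + ?B)"
    and "dim_col ?L = dim_col (constr_op_adj n m A + ?B)"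
    using B by auto
  fix i j assume "i < dim_row (constr_op_adj n m A + ?B)" "j < dim_col (constr_op_adj n m A + ?B)"
  then have ij: "i < m" "j < m" using B by auto
  have "?L $$ (i,j) = mat_inner (A_bar n l A i) (A_bar n l A j)"
    by (rule constr_op_adj_index) (use A ij in \<open>auto simp: A_bar_slack_block\<close>)
  also have "\<dots> = mat_inner (A i) (A j) + (if i < l then slack_block l j $$ (i,i) else 0)"
    by (simp add: A_bar_slack_block mat_inner_block_diag A ij mat_inner_slack_block)
  also have "\<dots> = constr_op_adj n m A $$ (i,j) + ?B $$ (i,j)"
    using ij lm by (auto simp: constr_op_adj_index A slack_block_index block_diag_def)
  finally show "?L $$ (i,j) = (constr_op_adj n m A + ?B) $$ (i,j)"
    using ij B by simp
qed

text \<open>The slack block of an inequality i reads off \<open>v $ i\<close>, while that of an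
  equality vanishes; hence the padding of \<open>v\<close> by zeros.\<close>

lemma constr_op_A_bar:
  assumes lm: "l \<le> m" and A: "\<And>i. i < m \<Longrightarrow> A i \<in> carrier_mat n n"
    and M: "M \<in> carrier_mat n n" and v: "v \<in> carrier_vec l"
  shows "constr_op m (A_bar n l A) (block_diag n l M (Diag v))
    = constr_op m A M + (v @\<^sub>v 0\<^sub>v (m - l))"
proof (rule eq_vecI)
  have D: "Diag v \<in> carrier_mat l l" using v by (auto simp: Diag_def)
  show "dim_vec (constr_op m (A_bar n l A) (block_diag n l M (Diag v)))
    = dim_vec (constr_op m A M + (v @\<^sub>v 0\<^sub>v (m - l)))"
    using v lm by (simp add: constr_op_def)
  fix i assume "i < dim_vec (constr_op m A M + (v @\<^sub>v 0\<^sub>v (m - l)))"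
  then have "i < m" using v lm by simp
  then show "constr_op m (A_bar n l A) (block_diag n l M (Diag v)) $ i
    = (constr_op m A M + (v @\<^sub>v 0\<^sub>v (m - l))) $ i"
    using v lm
    by (simp add: constr_op_def A_bar_slack_block mat_inner_block_diag A M D mat_inner_slack_block)
       (simp add: Diag_def mat_diag_def)
qed

text \<open>The argument of the operator in the update stays block diagonal with a diagonal slack
  block, so \<open>constr_op_A_bar\<close> applies to it. \<open>C_bar\<close> has a zero slack
  block and leaves only s and p there.\<close>

lemma block_diag_step:
  assumes "C \<in> carrier_mat n n" "X \<in> carrier_mat n n" "Z \<in> carrier_mat n n"
    and "s \<in> carrier_vec l" "p \<in> carrier_vec l"
  shows "a \<cdot>\<^sub>m X_bar n l X s - C_bar n l C + Z_bar n l Z p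
    = block_diag n l (a \<cdot>\<^sub>m X - C + Z) (Diag (a \<cdot>\<^sub>v s + p))"
  by (rule eq_matI)
     (use assms in \<open>auto simp: X_bar_def C_bar_def Z_bar_def block_diag_def Diag_def mat_diag_def\<close>)

text \<open>The invertibility claims ensure that \<open>the (mat_inverse _)\<close> denotes a
  genuine inverse on both sides. Besides the original matrices, the right-hand side uses only
  vectors and a fixed m by m correction.\<close>

theorem proposition1:
  fixes n m l :: nat
    and C X Z :: "real mat" and A :: "nat \<Rightarrow> real mat"
    and b s p :: "real vec" and \<sigma> :: real
  assumes "l \<le> m"
    and "C \<in> sym_mats n"
    and "\<And>i. i < m \<Longrightarrow> A i \<in> sym_mats n"
    and "b \<in> carrier_vec m"
    and "X \<in> sym_mats n" and "s \<in> carrier_vec l"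
    and "Z \<in> sym_mats n" and "p \<in> carrier_vec l"
    and "\<sigma> > 0"
    and "constr_lin_indep (n + l) m (A_bar n l A)"
  shows "invertible_mat (constr_op_adj (n + l) m (A_bar n l A))
    \<and> invertible_mat (constr_op_adj n m A + block_diag l (m - l) (1\<^sub>m l) (0\<^sub>m (m - l) (m - l)))
    \<and> adal_y_update (n + l) m \<sigma> b (C_bar n l C) (A_bar n l A) (X_bar n l X s) (Z_bar n l Z p)
      = the (mat_inverse
            (constr_op_adj n m A + block_diag l (m - l) (1\<^sub>m l) (0\<^sub>m (m - l) (m - l)))) *\<^sub>v
          ((1/\<sigma>) \<cdot>\<^sub>v b
            - (constr_op m A ((1/\<sigma>) \<cdot>\<^sub>m X - C + Z)
               + (((1/\<sigma>) \<cdot>\<^sub>v s + p) @\<^sub>v 0\<^sub>v (m - l))))"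
proof -
  have A: "A i \<in> carrier_mat n n" if "i < m" for i
    using assms(3)[OF that] by (simp add: sym_mats_def)
  have CXZ: "C \<in> carrier_mat n n" "X \<in> carrier_mat n n" "Z \<in> carrier_mat n n"
    using assms(2,5,7) by (auto simp: sym_mats_def)
  have gram: "constr_op_adj (n + l) m (A_bar n l A)
    = constr_op_adj n m A + block_diag l (m - l) (1\<^sub>m l) (0\<^sub>m (m - l) (m - l))"
    by (rule constr_op_adj_A_bar[OF assms(1) A])
  \<comment> \<open>Independence is assumed for the expanded family, while the \<open>A i\<close>
    alone may be dependent. Invertibility is therefore shown here and carried over by
    \<open>gram\<close>.\<close>
  have "invertible_mat (constr_op_adj (n + l) m (A_bar n l A))"
    by (rule invertible_constr_op_adj[OF sym_mats_A_bar[OF assms(3)] assms(10)])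
  moreover have "constr_op m (A_bar n l A)
      ((1/\<sigma>) \<cdot>\<^sub>m X_bar n l X s - C_bar n l C + Z_bar n l Z p)
    = constr_op m A ((1/\<sigma>) \<cdot>\<^sub>m X - C + Z) + (((1/\<sigma>) \<cdot>\<^sub>v s + p) @\<^sub>v 0\<^sub>v (m - l))"
    unfolding block_diag_step[OF CXZ assms(6,8)]
    by (rule constr_op_A_bar[OF assms(1) A]) (use CXZ assms(6,8) in auto)
  ultimately show ?thesis
    unfolding adal_y_update_def by (simp add: gram)
qed

end
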